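(* Let $X$ be a $T_0$ space. Then $X$ is a finitely approximated space if and only if $\mathcal{D}X$ is a quasicontinuous space.
   Context: For a $T_0$ space $X$ with topology $\mathcal{O}(X)$, order-theoretic notions refer to the specialization order: $x\le y$ iff $x\in\overline{\{y\}}$. For $A\subseteq X$, $\uparrow A=\{x: \exists a\in A,\ a\le x\}$. Directed sets are nonempty. A directed subset $D\subseteq X$ converges to $x$, written $D\to x$, iff $D\cap U\neq\emptyset$ for every open $U\ni x$. A set $U\subseteq X$ is monotone determined open if for all directed $D\subseteq X$ and all $x\in U$ with $D\to x$, $D\cap U\neq\emptyset$. $\mathcal{D}(X)$ is the collection of all monotone determined open sets; it is a $T_0$ topology containing $\mathcal{O}(X)$ with the same specialization order, and $\mathcal{D}X:=(X,\mathcal{D}(X))$. $X$ is a monotone determined space if it is $T_0$ and $\mathcal{D}(X)=\mathcal{O}(X)$. For finite sets $F,G\subseteq X$, $F\le G$ means $\uparrow G\subseteq\uparrow F$. A (nonempty) family $\mathcal{F}$ of finite subsets of $X$ is directed if for all $F_1,F_2\in\mathcal{F}$ there is $F\in\mathcal{F}$ with $F_1\le F$ and $F_2\le F$. Such a family converges to $x$ if for each open $U\ni x$ there is $F\in\mathcal{F}$ with $F\subseteq U$. For a finite $F$ and a point $x$ of a $T_0$ space $Y$, $F\ll_d x$ means: for every directed $D\subseteq Y$ with $D\to x$, $D\cap\uparrow F\ne\emptyset$. A $T_0$ space $Y$ is a finitely approximated space if for every $x\in Y$ the family $\{F\subseteq Y: F\text{ finite},\ F\ll_d x\}$ is directed and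 converges to $x$. A quasicontinuous space is a monotone determined space that satisfies this same condition (it is known that quasicontinuous spaces are exactly the locally hypercompact $T_0$ spaces). *)

theory Defs
  imports "HOL-Analysis.Analysis"
begin

text \<open>
  Spaces are abstract topologies \<open>X :: 'a topology\<close> with carrier \<open>topspace X\<close>.
  Order-theoretic notions refer to the specialization order on \<open>topspace X\<close>; since
  \<open>X closure_of {y}\<close> is empty for \<open>y \<notin> topspace X\<close>, \<open>spec_le X x y\<close> forces
  both points into \<open>topspace X\<close>.
\<close>

definition spec_le :: "'a topology \<Rightarrow> 'a \<Rightarrow> 'a \<Rightarrow> bool" where
  "spec_le X x y \<longleftrightarrow> x \<in> X closure_of {y}"

definition upset_of :: "'a topology \<Rightarrow> 'a set \<Rightarrow> 'a set" where
  "upset_of X A = {x \<in> topspace X. \<exists>a\<in>A. spec_le X a x}"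

definition directed_in :: "'a topology \<Rightarrow> 'a set \<Rightarrow> bool" where
  "directed_in X D \<longleftrightarrow> D \<subseteq> topspace X \<and> D \<noteq> {} \<and>
     (\<forall>a\<in>D. \<forall>b\<in>D. \<exists>c\<in>D. spec_le X a c \<and> spec_le X b c)"

definition dconverges :: "'a topology \<Rightarrow> 'a set \<Rightarrow> 'a \<Rightarrow> bool" where
  "dconverges X D x \<longleftrightarrow> (\<forall>U. openin X U \<and> x \<in> U \<longrightarrow> D \<inter> U \<noteq> {})"

definition md_open :: "'a topology \<Rightarrow> 'a set \<Rightarrow> bool" where
  "md_open X U \<longleftrightarrow> U \<subseteq> topspace X \<and>
     (\<forall>D x. directed_in X D \<and> x \<in> U \<and> dconverges X D x \<longrightarrow> D \<inter> U \<noteq> {})"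

text \<open>\<open>md_topology X\<close> is the space \<open>\<D>X\<close>; that its open sets are exactly the
  monotone determined open sets of \<open>X\<close> is \<open>openin_md_topology\<close> below.\<close>

definition md_topology :: "'a topology \<Rightarrow> 'a topology" where
  "md_topology X = topology (md_open X)"

definition monotone_determined_space :: "'a topology \<Rightarrow> bool" where
  "monotone_determined_space X \<longleftrightarrow> t0_space X \<and> {U. md_open X U} = {U. openin X U}"

definition fin_le :: "'a topology \<Rightarrow> 'a set \<Rightarrow> 'a set \<Rightarrow> bool" where
  "fin_le X F G \<longleftrightarrow> upset_of X G \<subseteq> upset_of X F"

definition directed_family :: "'a topology \<Rightarrow> 'a set set \<Rightarrow> bool" where
  "directed_family X \<F> \<longleftrightarrow> (\<forall>F\<in>\<F>. finite F \<and> F \<subseteq> topspace X) \<and> \<F> \<noteq> {} \<and>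
     (\<forall>F1\<in>\<F>. \<forall>F2\<in>\<F>. \<exists>F\<in>\<F>. fin_le X F1 F \<and> fin_le X F2 F)"

definition family_converges :: "'a topology \<Rightarrow> 'a set set \<Rightarrow> 'a \<Rightarrow> bool" where
  "family_converges X \<F> x \<longleftrightarrow> (\<forall>U. openin X U \<and> x \<in> U \<longrightarrow> (\<exists>F\<in>\<F>. F \<subseteq> U))"

definition d_way_below :: "'a topology \<Rightarrow> 'a set \<Rightarrow> 'a \<Rightarrow> bool" where
  "d_way_below Y F x \<longleftrightarrow>
     (\<forall>D. directed_in Y D \<and> dconverges Y D x \<longrightarrow> D \<inter> upset_of Y F \<noteq> {})"

definition fin_approximants :: "'a topology \<Rightarrow> 'a \<Rightarrow> 'a set set" where
  "fin_approximants Y x = {F. F \<subseteq> topspace Y \<and> finite F \<and> d_way_below Y F x}"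

definition finite_approximation_condition :: "'a topology \<Rightarrow> bool" where
  "finite_approximation_condition Y \<longleftrightarrow>
     (\<forall>x\<in>topspace Y. directed_family Y (fin_approximants Y x) \<and>
                     family_converges Y (fin_approximants Y x) x)"

definition finitely_approximated_space :: "'a topology \<Rightarrow> bool" where
  "finitely_approximated_space Y \<longleftrightarrow> t0_space Y \<and> finite_approximation_condition Y"

definition quasicontinuous_space :: "'a topology \<Rightarrow> bool" where
  "quasicontinuous_space Y \<longleftrightarrow>
     monotone_determined_space Y \<and> finite_approximation_condition Y"


lemma spec_le_iff:
  "spec_le X x y \<longleftrightarrow> x \<in> topspace X \<and> (\<forall>U. openin X U \<and> x \<in> U \<longrightarrow> y \<in> U)"
  unfolding spec_le_def in_closure_of by blast

lemma spec_le_refl: "x \<in> topspace X \<Longrightarrow> spec_le X x x"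
  by (simp add: spec_le_iff)

lemma spec_le_trans: "spec_le X x y \<Longrightarrow> spec_le X y z \<Longrightarrow> spec_le X x z"
  by (simp add: spec_le_iff)

lemma spec_le_topspace: "spec_le X x y \<Longrightarrow> x \<in> topspace X \<and> y \<in> topspace X"
  unfolding spec_le_iff using openin_topspace by blast

lemma openin_imp_md_open: "openin X U \<Longrightarrow> md_open X U"
  unfolding md_open_def dconverges_def using openin_subset by blast

lemma md_open_upward:
  assumes "md_open X U" "x \<in> U" "spec_le X x y"
  shows "y \<in> U"
proof -
  have "directed_in X {y}"
    unfolding directed_in_def using assms(3) by (auto dest: spec_le_topspace intro: spec_le_refl)
  moreover have "dconverges X {y} x"
    using assms(3) unfolding dconverges_def spec_le_iff by blast
  ultimately show ?thesis
    using assms(1,2) unfolding md_open_def by blast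
qed

lemma md_open_Int:
  assumes U: "md_open X U" and V: "md_open X V"
  shows "md_open X (U \<inter> V)"
  unfolding md_open_def
proof (intro conjI allI impI)
  show "U \<inter> V \<subseteq> topspace X"
    using U unfolding md_open_def by blast
next
  fix D x
  assume D: "directed_in X D \<and> x \<in> U \<inter> V \<and> dconverges X D x"
  then obtain d where d: "d \<in> D" "d \<in> U"
    using U unfolding md_open_def by blast
  define E where "E = {e \<in> D. spec_le X d e}"
  have up: "\<exists>c\<in>E. spec_le X a c" if "a \<in> D" for a
    using D d that unfolding directed_in_def E_def by blast
  have "directed_in X E"
    unfolding directed_in_def
  proof (intro conjI ballI)
    show "E \<subseteq> topspace X" "E \<noteq> {}"
      using D up d unfolding directed_in_def E_def by blast+
    fix a b assume ab: "a \<in> E" "b \<in> E"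
    then obtain c where "c \<in> D" "spec_le X a c" "spec_le X b c"
      using D unfolding directed_in_def E_def by blast
    then show "\<exists>c\<in>E. spec_le X a c \<and> spec_le X b c"
      using ab unfolding E_def by (blast intro: spec_le_trans)
  qed
  moreover have "dconverges X E x"
    unfolding dconverges_def
  proof (intro allI impI)
    fix W assume W: "openin X W \<and> x \<in> W"
    then obtain a where "a \<in> D" "a \<in> W"
      using D unfolding dconverges_def by blast
    then show "E \<inter> W \<noteq> {}"
      using up W unfolding spec_le_iff by blast
  qed
  ultimately obtain e where "e \<in> E" "e \<in> V"
    using D V unfolding md_open_def by blast
  then show "D \<inter> (U \<inter> V) \<noteq> {}"
    using md_open_upward[OF U d(2)] unfolding E_def by blast
qed

lemma istopology_md_open: "istopology (md_open X)"
proof -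
  have "md_open X (\<Union>\<K>)" if "\<forall>K\<in>\<K>. md_open X K" for \<K>
    using that unfolding md_open_def by blast
  then show ?thesis
    unfolding istopology_def using md_open_Int by blast
qed

lemma openin_md_topology: "openin (md_topology X) U \<longleftrightarrow> md_open X U"
  unfolding md_topology_def by (simp add: istopology_md_open)

lemma topspace_md_topology: "topspace (md_topology X) = topspace X"
proof
  show "topspace (md_topology X) \<subseteq> topspace X"
    using openin_topspace[of "md_topology X"] unfolding openin_md_topology md_open_def by blast
  show "topspace X \<subseteq> topspace (md_topology X)"
    by (simp add: openin_imp_md_open openin_md_topology openin_subset)
qed

lemma t0_space_md_topology: "t0_space X \<Longrightarrow> t0_space (md_topology X)"
  by (rule t0_space_expansive[of _ X])
    (simp_all add: topspace_md_topology openin_md_topology openin_imp_md_open)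

lemma spec_le_md_topology: "spec_le (md_topology X) = spec_le X"
proof (intro ext iffI)
  fix x y
  show "spec_le X x y" if "spec_le (md_topology X) x y"
    using that unfolding spec_le_iff openin_md_topology topspace_md_topology
    by (blast intro: openin_imp_md_open)
  show "spec_le (md_topology X) x y" if "spec_le X x y"
    unfolding spec_le_iff openin_md_topology topspace_md_topology
    using that md_open_upward spec_le_topspace by metis
qed

end

theory Submission
  imports Defs
begin

text \<open>
  A directed set converges to the same points in \<open>X\<close> and in \<open>\<D>X\<close>, so the two spaces
  share the relation \<open>\<lless>\<^sub>d\<close>, and the only point at issue is that the approximants of \<open>x\<close>
  converge to \<open>x\<close> for the finer topology. If none of them were contained in a monotone
  determined open \<open>U \<ni> x\<close>, then Rudin's lemma would give a directed set that misses \<open>U\<close> and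
  meets every approximant; it would converge to \<open>x\<close> in \<open>X\<close>, hence meet \<open>U\<close>.
\<close>

text \<open>By Zorn's lemma \<open>U\<close> extends to an upper set \<open>M\<close> maximal among
  those containing no member of \<open>\<F>\<close>; the required \<open>D\<close> is the complement
  of \<open>M\<close>. In contrast to the usual form of Rudin's lemma, \<open>D\<close> is made to
  avoid \<open>U\<close> rather than to lie in the union of \<open>\<F>\<close>.\<close>

lemma Rudin_avoiding:
  assumes dir: "directed_family X \<F>"
    and up: "\<And>x y. x \<in> U \<Longrightarrow> spec_le X x y \<Longrightarrow> y \<in> U"
    and not_sub: "\<And>F. F \<in> \<F> \<Longrightarrow> \<not> F \<subseteq> U"
  shows "\<exists>D. directed_in X D \<and> D \<inter> U = {} \<and> (\<forall>F\<in>\<F>. D \<inter> F \<noteq> {})"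
proof -
  have F_top: "finite F" "F \<subseteq> topspace X" if "F \<in> \<F>" for F
    using dir that unfolding directed_family_def by auto
  define \<A> where "\<A> = {V. U \<subseteq> V \<and> (\<forall>x\<in>V. \<forall>y. spec_le X x y \<longrightarrow> y \<in> V) \<and> (\<forall>F\<in>\<F>. \<not> F \<subseteq> V)}"
  have "\<exists>M\<in>\<A>. \<forall>V\<in>\<A>. M \<subseteq> V \<longrightarrow> V = M"
  proof (rule subset_Zorn_nonempty)
    show "\<A> \<noteq> {}"
      using up not_sub unfolding \<A>_def by blast
    fix \<C> assume C: "\<C> \<noteq> {}" "subset.chain \<A> \<C>"
    then have CA: "\<C> \<subseteq> \<A>"
      by (simp add: subset.chain_def)
    \<comment> \<open>Finiteness of \<open>F\<close> enters here: a finite set covered by a nonempty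
      chain lies in a single link.\<close>
    have "\<not> F \<subseteq> \<Union>\<C>" if F: "F \<in> \<F>" for F
    proof
      assume "F \<subseteq> \<Union>\<C>"
      then obtain V where "V \<in> \<C>" "F \<subseteq> V"
        using finite_subset_Union_chain[OF F_top(1)[OF F] _ C] by blast
      then show False
        using CA F unfolding \<A>_def by blast
    qed
    moreover have "U \<subseteq> \<Union>\<C>"
      using C(1) CA unfolding \<A>_def by blast
    moreover have "\<forall>x\<in>\<Union>\<C>. \<forall>y. spec_le X x y \<longrightarrow> y \<in> \<Union>\<C>"
      using CA unfolding \<A>_def by blast
    ultimately show "\<Union>\<C> \<in> \<A>"
      unfolding \<A>_def by blast
  qed
  then obtain M where M: "M \<in> \<A>" and maxi: "\<And>V. V \<in> \<A> \<Longrightarrow> M \<subseteq> V \<Longrightarrow> V = M"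
    by blast
  have UM: "U \<subseteq> M" and M_up: "\<And>x y. x \<in> M \<Longrightarrow> spec_le X x y \<Longrightarrow> y \<in> M"
    and M_not: "\<And>F. F \<in> \<F> \<Longrightarrow> \<not> F \<subseteq> M"
    using M unfolding \<A>_def by blast+
  \<comment> \<open>Members of \<open>\<A>\<close> are not confined to the carrier, so the
    complement is taken in \<open>topspace X\<close>.\<close>
  have meets: "(topspace X - M) \<inter> F \<noteq> {}" if "F \<in> \<F>" for F
    using F_top(2)[OF that] M_not[OF that] by blast
  \<comment> \<open>Otherwise adjoining the upper set of \<open>a\<close> would give a strictly
    larger member of \<open>\<A>\<close>.\<close>
  have ex: "\<exists>F\<in>\<F>. F \<subseteq> M \<union> upset_of X {a}" if a: "a \<in> topspace X - M" for a
  proof (rule ccontr)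
    assume "\<not> ?thesis"
    moreover have "y \<in> M \<union> upset_of X {a}"
      if "x \<in> M \<union> upset_of X {a}" "spec_le X x y" for x y
      using that by (auto simp: upset_of_def dest: M_up spec_le_trans spec_le_topspace)
    ultimately have "M \<union> upset_of X {a} \<in> \<A>"
      using UM unfolding \<A>_def mem_Collect_eq by (meson le_supI1)
    then have "upset_of X {a} \<subseteq> M"
      using maxi by blast
    then show False
      using a spec_le_refl[of a X] by (auto simp: upset_of_def)
  qed
  \<comment> \<open>Some \<open>f \<in> F\<close> lies below \<open>c\<close>. As \<open>M\<close>
    is an upper set missing \<open>c\<close>, it misses \<open>f\<close> too, so \<open>f\<close>
    can only come from the upper set of \<open>a\<close>.\<close>
  have above: "spec_le X a c"
    if F: "F \<subseteq> M \<union> upset_of X {a}" "fin_le X F G" and c: "c \<in> (topspace X - M) \<inter> G" for a c F G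
  proof -
    have "c \<in> upset_of X F"
      using F(2) c spec_le_refl[of c X] by (auto simp: fin_le_def upset_of_def)
    then obtain f where f: "f \<in> F" "spec_le X f c"
      by (auto simp: upset_of_def)
    then have "f \<in> upset_of X {a}"
      using F(1) M_up c by blast
    then show ?thesis
      using f(2) by (auto simp: upset_of_def intro: spec_le_trans)
  qed
  have "directed_in X (topspace X - M)"
    unfolding directed_in_def
  proof (intro conjI ballI)
    show "topspace X - M \<noteq> {}"
      using dir meets by (metis Int_empty_left directed_family_def ex_in_conv)
    fix a b assume ab: "a \<in> topspace X - M" "b \<in> topspace X - M"
    obtain F1 where F1: "F1 \<in> \<F>" "F1 \<subseteq> M \<union> upset_of X {a}"
      using ex[OF ab(1)] by blast
    obtain F2 where F2: "F2 \<in> \<F>" "F2 \<subseteq> M \<union> upset_of X {b}"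
      using ex[OF ab(2)] by blast
    obtain G where G: "G \<in> \<F>" "fin_le X F1 G" "fin_le X F2 G"
      using dir F1(1) F2(1) unfolding directed_family_def by metis
    then obtain c where "c \<in> (topspace X - M) \<inter> G"
      using meets[OF G(1)] by blast
    then show "\<exists>c\<in>topspace X - M. spec_le X a c \<and> spec_le X b c"
      using above[OF F1(2) G(2)] above[OF F2(2) G(3)] by blast
  qed auto
  then show ?thesis
    using UM meets by (intro exI[of _ "topspace X - M"]) auto
qed

lemma directed_in_md_topology: "directed_in (md_topology X) = directed_in X"
  by (simp add: fun_eq_iff directed_in_def topspace_md_topology spec_le_md_topology)

lemma upset_of_md_topology: "upset_of (md_topology X) = upset_of X"
  by (simp add: fun_eq_iff upset_of_def topspace_md_topology spec_le_md_topology)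

text \<open>A monotone determined open set meets, by definition, every directed set converging in
  \<open>X\<close> to one of its points, so refining the topology destroys no directed
  limit.\<close>

lemma dconverges_md_topology:
  assumes "directed_in X D"
  shows "dconverges (md_topology X) D x \<longleftrightarrow> dconverges X D x"
proof
  show "dconverges X D x" if "dconverges (md_topology X) D x"
    using that by (simp add: dconverges_def openin_md_topology openin_imp_md_open)
  show "dconverges (md_topology X) D x" if "dconverges X D x"
    unfolding dconverges_def[of "md_topology X"] openin_md_topology
  proof (intro allI impI)
    fix U assume "md_open X U \<and> x \<in> U"
    then show "D \<inter> U \<noteq> {}"
      using assms that unfolding md_open_def by metis
  qed
qed

text \<open>Idempotence of the construction: directed sets and their limits are unchanged. The rule
  \<open>conj_cong\<close> supplies the directedness under which convergence may be
  rewritten.\<close>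

lemma md_open_md_topology: "md_open (md_topology X) U \<longleftrightarrow> md_open X U"
  by (simp add: md_open_def directed_in_md_topology topspace_md_topology dconverges_md_topology
      cong: conj_cong)

lemma monotone_determined_space_md_topology:
  "t0_space X \<Longrightarrow> monotone_determined_space (md_topology X)"
  by (simp add: monotone_determined_space_def t0_space_md_topology md_open_md_topology
      openin_md_topology)

lemma fin_approximants_md_topology: "fin_approximants (md_topology X) = fin_approximants X"
proof -
  have "d_way_below (md_topology X) F x \<longleftrightarrow> d_way_below X F x" for F x
    by (simp add: d_way_below_def directed_in_md_topology upset_of_md_topology
        dconverges_md_topology cong: conj_cong)
  then show ?thesis
    by (simp add: fun_eq_iff fin_approximants_def topspace_md_topology)
qed

lemma directed_family_md_topology: "directed_family (md_topology X) = directed_family X"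
  by (simp add: fun_eq_iff directed_family_def fin_le_def topspace_md_topology upset_of_md_topology)

lemma family_converges_md_topology:
  assumes "directed_family X \<F>"
  shows "family_converges (md_topology X) \<F> x \<longleftrightarrow> family_converges X \<F> x"
proof
  show "family_converges X \<F> x" if "family_converges (md_topology X) \<F> x"
    using that unfolding family_converges_def openin_md_topology by (blast intro: openin_imp_md_open)
next
  assume conv: "family_converges X \<F> x"
  show "family_converges (md_topology X) \<F> x"
    unfolding family_converges_def openin_md_topology
  proof (intro allI impI)
    fix U assume U: "md_open X U \<and> x \<in> U"
    show "\<exists>F\<in>\<F>. F \<subseteq> U"
    proof (rule ccontr)
      assume "\<not> ?thesis"
      then have "\<And>F. F \<in> \<F> \<Longrightarrow> \<not> F \<subseteq> U"
        by blast
      \<comment> \<open>Monotone determined open sets are upper sets, as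
        \<open>Rudin_avoiding\<close> demands of \<open>U\<close>.\<close>
      with assms md_open_upward[OF conjunct1[OF U]]
      have "\<exists>D. directed_in X D \<and> D \<inter> U = {} \<and> (\<forall>F\<in>\<F>. D \<inter> F \<noteq> {})"
        by (rule Rudin_avoiding)
      then obtain D where D: "directed_in X D" "D \<inter> U = {}" "\<forall>F\<in>\<F>. D \<inter> F \<noteq> {}"
        by blast
      have "dconverges X D x"
        unfolding dconverges_def
      proof (intro allI impI)
        fix V assume "openin X V \<and> x \<in> V"
        then obtain F where "F \<in> \<F>" "F \<subseteq> V"
          using conv unfolding family_converges_def by metis
        then show "D \<inter> V \<noteq> {}"
          using D(3) by fastforce
      qed
      then show False
        using U D unfolding md_open_def by blast
    qed
  qed
qed

theorem theorem3p24:
  fixes X :: "'a topology"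
  assumes "t0_space X"
  shows "finitely_approximated_space X \<longleftrightarrow> quasicontinuous_space (md_topology X)"
proof -
  \<comment> \<open>Directedness of the approximants, the first conjunct of the condition, is what
    allows their convergence to be transferred.\<close>
  have "finite_approximation_condition (md_topology X) \<longleftrightarrow> finite_approximation_condition X"
    by (simp add: finite_approximation_condition_def topspace_md_topology
        fin_approximants_md_topology directed_family_md_topology family_converges_md_topology
        cong: conj_cong)
  then show ?thesis
    using assms
    by (simp add: finitely_approximated_space_def quasicontinuous_space_def
        monotone_determined_space_md_topology)
qed

end
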